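(* Suppose that $G$ and $H$ are centerless Polish groups, each with dense (abstract) commutator subgroup, and that there exists a normal compression $\psi: G\to H$. Then $G$ is topologically simple if and only if $H$ is topologically simple.
   Context: A Polish group is a topological group whose topology is separable and completely metrizable. A normal compression is a continuous injective homomorphism $\psi: G\to H$ whose image is dense and normal in $H$. A topological group is topologically simple if it is non-trivial and has no proper non-trivial closed normal subgroup. Centerless means having trivial center. *)

theory Defs
  imports "HOL-Analysis.Analysis" "HOL-Algebra.Generated_Groups"
begin

locale topological_group = group G for G (structure) +
  fixes T :: "'a topology"
  assumes topspace_eq: "topspace T = carrier G"
    and continuous_mult: "continuous_map (prod_topology T T) T (\<lambda>(x, y). x \<otimes> y)"
    and continuous_inv: "continuous_map T T (\<lambda>x. inv x)"

locale polish_group = topological_group +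
  assumes separable: "separable_space T"
    and completely_metrizable: "completely_metrizable_space T"

definition group_center :: "('a, 'b) monoid_scheme \<Rightarrow> 'a set" where
  "group_center G = {z \<in> carrier G. \<forall>x \<in> carrier G. z \<otimes>\<^bsub>G\<^esub> x = x \<otimes>\<^bsub>G\<^esub> z}"

definition centerless :: "('a, 'b) monoid_scheme \<Rightarrow> bool" where
  "centerless G \<longleftrightarrow> group_center G = {\<one>\<^bsub>G\<^esub>}"

definition dense_in_topology :: "'a topology \<Rightarrow> 'a set \<Rightarrow> bool" where
  "dense_in_topology T S \<longleftrightarrow> S \<subseteq> topspace T \<and> T closure_of S = topspace T"

definition topologically_simple :: "('a, 'b) monoid_scheme \<Rightarrow> 'a topology \<Rightarrow> bool" where
  "topologically_simple G T \<longleftrightarrow>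
     topological_group G T \<and> carrier G \<noteq> {\<one>\<^bsub>G\<^esub>} \<and>
     (\<forall>N. N \<lhd> G \<and> closedin T N \<longrightarrow> N = {\<one>\<^bsub>G\<^esub>} \<or> N = carrier G)"

definition normal_compression ::
  "('a, 'c) monoid_scheme \<Rightarrow> 'a topology \<Rightarrow> ('b, 'd) monoid_scheme \<Rightarrow> 'b topology \<Rightarrow>
    ('a \<Rightarrow> 'b) \<Rightarrow> bool" where
  "normal_compression G T H S \<psi> \<longleftrightarrow>
     \<psi> \<in> hom G H \<and> continuous_map T S \<psi> \<and> inj_on \<psi> (carrier G) \<and>
     dense_in_topology S (\<psi> ` carrier G) \<and> \<psi> ` carrier G \<lhd> H"

end

theory Submission
  imports Defs
begin

text \<open>Let \<open>\<psi>\<close> be a normal compression of \<open>G\<close> into \<open>H\<close>.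

  Simplicity passes from \<open>G\<close> to \<open>H\<close> because a closed normal subgroup of \<open>H\<close> that meets the image of
  \<open>\<psi>\<close> trivially commutes with this dense normal subgroup, so it is central and hence trivial
  (\<open>topologically_simple_codomain\<close>).

  For the converse (\<open>topologically_simple_domain\<close>), let \<open>N\<close> be a non-trivial closed normal subgroup of
  \<open>G\<close>. The closure of its image is a non-trivial closed normal subgroup of \<open>H\<close>, so \<open>\<psi> ` N\<close> is dense. The
  group \<open>H\<close> acts on \<open>G\<close> by conjugation through \<open>\<psi>\<close>. The elements of \<open>\<psi> ` N\<close> act trivially modulo
  \<open>N\<close>; if the orbit maps \<open>h \<mapsto> act h g\<close> from \<open>H\<close> to \<open>G\<close> are continuous, then by density all of \<open>H\<close>
  acts trivially modulo \<open>N\<close>. In particular \<open>G\<close> does, so \<open>N\<close> contains all commutators of \<open>G\<close>, and these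
  generate a dense subgroup.

  The analytic core is the continuity of the orbit maps for the topology of \<open>G\<close>, which may be strictly
  finer than the one induced from \<open>H\<close> (\<open>continuous_orbit_map\<close>). It comes from a Baire category
  argument. A map with closed graph between Polish spaces is continuous off a meager set
  (\<open>closed_graph_continuous_off_meager\<close>). If its domain is a Polish group and translations of the
  domain correspond to continuous maps of the codomain, a suitable translation moves any
  convergent sequence off the meager set, so the map is continuous everywhere
  (\<open>closed_graph_translation_continuous\<close>). This criterion is used twice: for the automorphism of
  \<open>G\<close> given by one element of \<open>H\<close>, and then, with these automorphisms as the maps of the codomain,
  for the orbit maps.\<close>

section \<open>Baire category in abstract topological spaces\<close>

lemma separable_metrizable_imp_second_countable:
  assumes "metrizable_space X" "separable_space X"
  shows "second_countable X"
proof -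
  obtain M d where "Metric_space M d" and X: "X = Metric_space.mtopology M d"
    using assms(1) unfolding metrizable_space_def by blast
  then interpret Metric_space M d by simp
  obtain Q where Q: "countable Q" "Q \<subseteq> M" "X closure_of Q = M"
    using assms(2) X unfolding separable_space_def by auto
  let ?B = "(\<lambda>(q, n). mball q (inverse (real (Suc n)))) ` (Q \<times> UNIV)"
  show ?thesis
    unfolding second_countable_def
  proof (intro exI [of _ ?B] conjI strip)
    show "countable ?B" using Q by auto
    show "openin X V" if "V \<in> ?B" for V using that X by auto
    fix U x assume "openin X U \<and> x \<in> U"
    then obtain r where r: "r > 0" "mball x r \<subseteq> U" and x: "x \<in> M"
      using X openin_mtopology by blast
    obtain n where n: "inverse (real (Suc n)) < r / 2"
      using r reals_Archimedean [of "r/2"] by auto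
    have "x \<in> X closure_of Q" using x Q by simp
    then obtain q where q: "q \<in> Q" "q \<in> mball x (inverse (real (Suc n)))"
      unfolding X metric_closure_of
      by (smt (verit, best) inverse_positive_iff_positive mem_Collect_eq of_nat_0_less_iff zero_less_Suc)
    have "mball q (inverse (real (Suc n))) \<subseteq> mball x r"
    proof
      fix y assume y: "y \<in> mball q (inverse (real (Suc n)))"
      then show "y \<in> mball x r"
        using q n triangle [of x q y] by auto
    qed
    then show "\<exists>V\<in>?B. x \<in> V \<and> V \<subseteq> U"
      using q r Q x commute by (intro bexI [of _ "mball q (inverse (real (Suc n)))"]) auto
  qed
qed

text \<open>Covering by closed sets with empty interior, rather than by nowhere dense sets, makes the
  Baire category theorem applicable to the witness family as it stands.\<close>
definition meager_in :: "'a topology \<Rightarrow> 'a set \<Rightarrow> bool" where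
  "meager_in X A \<longleftrightarrow>
     (\<exists>\<F>. countable \<F> \<and> (\<forall>F\<in>\<F>. closedin X F \<and> X interior_of F = {}) \<and> A \<subseteq> \<Union>\<F>)"

lemma meager_in_subset: "meager_in X B \<Longrightarrow> A \<subseteq> B \<Longrightarrow> meager_in X A"
  unfolding meager_in_def by (meson subset_trans)

lemma meager_in_empty: "meager_in X {}"
  unfolding meager_in_def by (intro exI [of _ "{}"]) auto

lemma meager_in_UN:
  assumes "countable I" "\<And>i. i \<in> I \<Longrightarrow> meager_in X (A i)"
  shows "meager_in X (\<Union>i\<in>I. A i)"
proof -
  obtain \<F> where \<F>: "\<And>i. i \<in> I \<Longrightarrow> countable (\<F> i) \<and>
      (\<forall>F\<in>\<F> i. closedin X F \<and> X interior_of F = {}) \<and> A i \<subseteq> \<Union>(\<F> i)"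
    using assms(2) unfolding meager_in_def by metis
  show ?thesis
    unfolding meager_in_def
  proof (intro exI [of _ "\<Union>i\<in>I. \<F> i"] conjI)
    show "countable (\<Union>i\<in>I. \<F> i)" using \<F> assms(1) by blast
    show "\<forall>F\<in>\<Union> (\<F> ` I). closedin X F \<and> X interior_of F = {}" using \<F> by blast
    have "A i \<subseteq> \<Union> (\<Union> (\<F> ` I))" if "i \<in> I" for i
      using \<F> [OF that] that by (meson SUP_upper Sup_subset_mono subset_trans)
    then show "\<Union> (A ` I) \<subseteq> \<Union> (\<Union> (\<F> ` I))" by (rule UN_least)
  qed
qed

lemma meager_in_Un:
  assumes "meager_in X A" "meager_in X B"
  shows "meager_in X (A \<union> B)"
proof -
  have "meager_in X (\<Union>i\<in>{A, B}. i)"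
    by (rule meager_in_UN) (use assms in auto)
  then show ?thesis by simp
qed

lemma meager_in_boundary_of_open:
  assumes "openin X U"
  shows "meager_in X (X closure_of U - U)"
  unfolding meager_in_def
proof (intro exI [of _ "{X closure_of U - U}"] conjI ballI)
  fix F assume "F \<in> {X closure_of U - U}"
  then have F: "F = X closure_of U - U" by simp
  show "closedin X F" using assms F by (simp add: closedin_diff)
  have "X interior_of F \<inter> U = {}"
    using interior_of_subset [of X F] F by auto
  then have "X interior_of F \<inter> X closure_of U = {}"
    by (simp add: openin_Int_closure_of_eq_empty)
  then show "X interior_of F = {}"
    using interior_of_subset [of X F] F by auto
qed auto

lemma meager_in_topspace_iff_empty:
  assumes "completely_metrizable_space X" "meager_in X (topspace X)"
  shows "topspace X = {}"
proof -
  obtain \<F> where \<F>: "countable \<F>" "\<And>F. F\<in>\<F> \<Longrightarrow> closedin X F \<and> X interior_of F = {}"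
    "topspace X \<subseteq> \<Union>\<F>"
    using assms(2) unfolding meager_in_def by blast
  then have "X interior_of \<Union>\<F> = {}" using Baire_category_alt assms(1) by blast
  moreover have "\<Union>\<F> = topspace X" using \<F> closedin_subset by blast
  ultimately show ?thesis by (metis interior_of_topspace)
qed

lemma meager_in_homeomorphic_image:
  assumes h: "homeomorphic_map X Y h" and A: "meager_in X A"
  shows "meager_in Y (h ` A)"
proof -
  obtain \<F> where \<F>: "countable \<F>" "\<And>F. F\<in>\<F> \<Longrightarrow> closedin X F \<and> X interior_of F = {}" "A \<subseteq> \<Union>\<F>"
    using A unfolding meager_in_def by blast
  show ?thesis
    unfolding meager_in_def
  proof (intro exI [of _ "(`) h ` \<F>"] conjI ballI)
    fix F' assume "F' \<in> (`) h ` \<F>"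
    then obtain F where F: "F \<in> \<F>" "F' = h ` F" by blast
    then have "F \<subseteq> topspace X" using \<F>(2) closedin_subset by blast
    then show "closedin Y F'" "Y interior_of F' = {}"
      using F \<F>(2) homeomorphic_map_closedness [OF h] homeomorphic_map_interior_of [OF h] by auto
  next
    show "h ` A \<subseteq> \<Union> ((`) h ` \<F>)" using \<F>(3) by blast
  qed (use \<F>(1) in auto)
qed

text \<open>The set \<open>V\<close> is the complement of the closure of the largest open set \<open>N\<close> in which \<open>A\<close> is
  meager. A countable base makes \<open>N \<inter> A\<close> a countable union of meager sets, and the boundary of
  \<open>N\<close> is meager, so \<open>V\<close> contains \<open>A\<close> up to a meager set. On the other hand \<open>A\<close> is non-meager
  in every non-empty open part of \<open>V\<close>. Since \<open>A\<close> is arbitrary, \<open>V - A\<close>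
  itself need not be meager.\<close>
lemma Baire_hull:
  assumes "second_countable X" "A \<subseteq> topspace X"
  obtains V where "openin X V" "meager_in X (A - V)" "V \<subseteq> X closure_of A"
    "\<And>W. \<lbrakk>openin X W; W \<subseteq> V; meager_in X (W \<inter> A)\<rbrakk> \<Longrightarrow> W = {}"
proof -
  obtain \<B> where \<B>: "countable \<B>" "\<And>B. B \<in> \<B> \<Longrightarrow> openin X B"
    "\<And>U x. \<lbrakk>openin X U; x \<in> U\<rbrakk> \<Longrightarrow> \<exists>B \<in> \<B>. x \<in> B \<and> B \<subseteq> U"
    using assms(1) unfolding second_countable_def by metis
  define N where "N = \<Union>{B \<in> \<B>. meager_in X (B \<inter> A)}"
  define V where "V = topspace X - X closure_of N"
  have N: "openin X N" unfolding N_def using \<B>(2) by blast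
  have "N \<inter> A = (\<Union>B\<in>{B \<in> \<B>. meager_in X (B \<inter> A)}. B \<inter> A)" unfolding N_def by blast
  moreover have "meager_in X \<dots>"
    using \<B>(1) by (intro meager_in_UN) (auto intro: countable_subset [OF _ \<B>(1)])
  ultimately have NA: "meager_in X (N \<inter> A)" by simp
  have hull: "W = {}" if W: "openin X W" "W \<subseteq> V" "meager_in X (W \<inter> A)" for W
  proof (rule ccontr)
    assume "W \<noteq> {}"
    then obtain x where x: "x \<in> W" by blast
    then obtain B where B: "B \<in> \<B>" "x \<in> B" "B \<subseteq> W" using \<B>(3) [OF W(1)] by blast
    then have "meager_in X (B \<inter> A)" by (intro meager_in_subset [OF W(3)]) auto
    then have "x \<in> N" using B unfolding N_def by auto
    then have "x \<in> X closure_of N" using closure_of_subset [OF openin_subset [OF N]] by (rule rev_subsetD)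
    moreover have "x \<notin> X closure_of N" using x W(2) unfolding V_def by (auto dest: subsetD)
    ultimately show False by simp
  qed
  show ?thesis
  proof
    show "openin X V" unfolding V_def by (simp add: openin_diff)
    show "W = {}" if "openin X W" "W \<subseteq> V" "meager_in X (W \<inter> A)" for W
      using that by (rule hull)
    show "V \<subseteq> X closure_of A"
    proof -
      have "V - X closure_of A = {}"
      proof (rule hull)
        show "openin X (V - X closure_of A)" unfolding V_def by (simp add: openin_diff)
        have "(V - X closure_of A) \<inter> A = {}" using closure_of_subset [OF assms(2)] by auto
        then show "meager_in X ((V - X closure_of A) \<inter> A)" by (simp add: meager_in_empty)
      qed auto
      then show ?thesis by auto
    qed
    show "meager_in X (A - V)"
      using meager_in_Un [OF NA meager_in_boundary_of_open [OF N]]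
    proof (rule meager_in_subset)
      show "A - V \<subseteq> N \<inter> A \<union> (X closure_of N - N)"
        using assms(2) unfolding V_def by blast
    qed
  qed
qed

section \<open>Functions with closed graph between Polish spaces\<close>

text \<open>It suffices that off a meager set every preimage \<open>A U\<close> of a basic open set agrees with an open
  set, and the Baire hull \<open>V U\<close> serves as this open set. One inclusion holds up to a meager set by
  the choice of the hull. For the other, \<open>A U\<close> is the union of the \<open>A B\<close> over the small basic sets
  \<open>B\<close> whose closure lies in \<open>U\<close>, and therefore \<open>V U\<close> is, up to a meager set, covered by the
  corresponding hulls \<open>V B\<close>. Hence a point \<open>x\<close> of \<open>V U\<close> outside a meager set
  determines a sequence of shrinking basic sets \<open>u n\<close> with \<open>x \<in> V (u n)\<close>, starting at \<open>U\<close>. By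
  completeness these shrink to a point \<open>y \<in> U\<close>. Since \<open>V (u n)\<close> lies in the closure of \<open>A (u n)\<close>,
  there are points near \<open>x\<close> whose values are near \<open>y\<close>, so \<open>(x, y)\<close> lies in the closure of the
  graph and \<open>y = f x\<close>.\<close>
lemma closed_graph_continuous_off_meager:
  assumes X: "second_countable X"
    and Y: "second_countable Y" "completely_metrizable_space Y"
    and f: "f \<in> topspace X \<rightarrow> topspace Y"
    and graph: "closedin (prod_topology X Y) {(x, f x) | x. x \<in> topspace X}"
  obtains M where "meager_in X M" "continuous_map (subtopology X (topspace X - M)) Y f"
proof -
  obtain S d where "Metric_space S d" and mcompl: "Metric_space.mcomplete S d"
    and Y_eq: "Y = Metric_space.mtopology S d"
    using Y(2) unfolding completely_metrizable_space_def by blast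
  then interpret Metric_space S d by simp
  obtain \<B> where \<B>: "countable \<B>" "\<And>B. B \<in> \<B> \<Longrightarrow> openin Y B"
    and base: "\<And>U y. \<lbrakk>openin Y U; y \<in> U\<rbrakk> \<Longrightarrow> \<exists>B \<in> \<B>. y \<in> B \<and> B \<subseteq> U"
    using Y(1) unfolding second_countable_def by metis
  define A where "A U = {x \<in> topspace X. f x \<in> U}" for U
  have "\<exists>V. openin X V \<and> meager_in X (A U - V) \<and> V \<subseteq> X closure_of (A U) \<and>
      (\<forall>W. openin X W \<and> W \<subseteq> V \<and> meager_in X (W \<inter> A U) \<longrightarrow> W = {})" for U
  proof -
    have "A U \<subseteq> topspace X" unfolding A_def by auto
    from Baire_hull [OF X this] show ?thesis by metis
  qed
  then obtain V where V: "\<And>U. openin X (V U)" "\<And>U. meager_in X (A U - V U)"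
      "\<And>U. V U \<subseteq> X closure_of (A U)"
      "\<And>U W. \<lbrakk>openin X W; W \<subseteq> V U; meager_in X (W \<inter> A U)\<rbrakk> \<Longrightarrow> W = {}"
    by metis
  define R where "R U n = {B \<in> \<B>. Y closure_of B \<subseteq> U \<and> (\<exists>y. B \<subseteq> mball y ((1/2)^n))}" for U and n :: nat
  have countable_R: "countable (R U n)" for U n
    unfolding R_def using \<B>(1) by (auto intro: countable_subset [OF _ \<B>(1)])
  have A_cover: "A U \<subseteq> (\<Union>B\<in>R U n. A B)" if U: "U \<in> \<B>" for U n
  proof
    fix x assume "x \<in> A U"
    then have x: "x \<in> topspace X" "f x \<in> U" unfolding A_def by auto
    obtain r where r: "r > 0" "mball (f x) r \<subseteq> U"
      using x(2) \<B>(2) [OF U] unfolding Y_eq openin_mtopology by blast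
    define s where "s = min (r/2) ((1/2)^n)"
    have "s > 0" using r unfolding s_def by simp
    moreover have "f x \<in> S" using x f unfolding Y_eq by auto
    ultimately obtain B where B: "B \<in> \<B>" "f x \<in> B" "B \<subseteq> mball (f x) s"
      using base [of "mball (f x) s" "f x"] unfolding Y_eq by auto
    have "Y closure_of B \<subseteq> mcball (f x) s"
      unfolding Y_eq using B(3) mball_subset_mcball by (intro closure_of_minimal) auto
    also have "\<dots> \<subseteq> mball (f x) r"
      using r unfolding s_def by (intro mcball_subset_mball_concentric) auto
    finally have "Y closure_of B \<subseteq> U" using r by auto
    moreover have "B \<subseteq> mball (f x) ((1/2)^n)"
      using B(3) mball_subset_concentric [of s "(1/2)^n" "f x"] unfolding s_def by auto
    ultimately have "B \<in> R U n" unfolding R_def using B by blast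
    then show "x \<in> (\<Union>B\<in>R U n. A B)" using x B unfolding A_def by blast
  qed
  define M where "M = (\<Union>U\<in>\<B>. A U - V U) \<union> (\<Union>(U, n)\<in>\<B> \<times> UNIV. V U - (\<Union>B\<in>R U n. V B))"
  \<comment> \<open>The part of \<open>V U\<close> outside the closure of the smaller hulls is open and meets \<open>A U\<close> in a
    meager set, so it is empty by the last property of a Baire hull; only a boundary remains.\<close>
  have gap: "meager_in X (V U - (\<Union>B\<in>R U n. V B))" if U: "U \<in> \<B>" for U n
  proof -
    define N where "N = (\<Union>B\<in>R U n. V B)"
    have N: "openin X N" unfolding N_def using V(1) by blast
    define W where "W = V U - X closure_of N"
    have "W \<inter> A U \<subseteq> (\<Union>B\<in>R U n. A B - V B)"
    proof
      fix x assume x: "x \<in> W \<inter> A U"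
      then obtain B where B: "B \<in> R U n" "x \<in> A B" using A_cover [OF U, of n] by blast
      have "x \<notin> N" using x closure_of_subset [OF openin_subset [OF N]] unfolding W_def by blast
      then show "x \<in> (\<Union>B\<in>R U n. A B - V B)" using B unfolding N_def by blast
    qed
    moreover have "meager_in X (\<Union>B\<in>R U n. A B - V B)"
      using countable_R V(2) by (rule meager_in_UN)
    ultimately have "meager_in X (W \<inter> A U)" by (rule meager_in_subset [rotated])
    moreover have "openin X W" unfolding W_def by (intro openin_diff V closedin_closure_of)
    moreover have "W \<subseteq> V U" unfolding W_def by blast
    ultimately have "W = {}" using V(4) by blast
    then have "V U - N \<subseteq> X closure_of N - N" unfolding W_def by blast
    then show ?thesis
      using meager_in_boundary_of_open [OF N] meager_in_subset unfolding N_def by blast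
  qed
  have "meager_in X M"
    unfolding M_def
  proof (rule meager_in_Un)
    show "meager_in X (\<Union>U\<in>\<B>. A U - V U)" using \<B>(1) V(2) by (rule meager_in_UN)
    show "meager_in X (\<Union>(U, n)\<in>\<B> \<times> UNIV. V U - (\<Union>B\<in>R U n. V B))"
      using \<B>(1) gap by (intro meager_in_UN) auto
  qed
  moreover have A_V: "x \<in> A U \<longleftrightarrow> x \<in> V U" if x: "x \<in> topspace X" "x \<notin> M" and U: "U \<in> \<B>" for x U
  proof
    assume "x \<in> A U" then show "x \<in> V U" using x U unfolding M_def by blast
  next
    assume xU: "x \<in> V U"
    have step: "\<exists>B'. (B' \<in> \<B> \<and> x \<in> V B') \<and> B' \<in> R B n" if "B \<in> \<B> \<and> x \<in> V B" for B n
    proof -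
      have "x \<in> (\<Union>B'\<in>R B n. V B')" using that x unfolding M_def by blast
      then show ?thesis unfolding R_def by blast
    qed
    obtain u where u0: "u 0 = U" and u: "\<And>n. u n \<in> \<B> \<and> x \<in> V (u n)" "\<And>n. u (Suc n) \<in> R (u n) n"
    proof -
      have "\<exists>g. \<forall>n. ((g n \<in> \<B> \<and> x \<in> V (g n)) \<and> (n = 0 \<longrightarrow> g n = U)) \<and> g (Suc n) \<in> R (g n) n"
        by (rule dependent_nat_choice) (use U xU step in auto)
      then show ?thesis using that by blast
    qed
    define C where "C n = Y closure_of (u (Suc n))" for n
    have C_sub: "C n \<subseteq> u n" for n using u(2) [of n] unfolding R_def C_def by blast
    have u_sub: "u n \<subseteq> C m" if "n = Suc m" for n m
      unfolding C_def that using \<B>(2) u(1) by (metis closure_of_subset openin_subset)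
    have "\<Inter> (range C) \<noteq> {}"
    proof (rule mcompl [unfolded mcomplete_nest, rule_format], intro conjI allI impI)
      show "closedin mtopology (C n)" for n unfolding C_def Y_eq by simp
      show "C n \<noteq> {}" for n
      proof -
        have "x \<in> X closure_of (A (u (Suc n)))" using V(3) u(1) by blast
        then have "A (u (Suc n)) \<noteq> {}" by auto
        then show ?thesis using u_sub [of "Suc n" n] unfolding A_def by blast
      qed
      show "decseq C"
        using C_sub u_sub by (intro decseq_SucI) blast
      fix e :: real assume "e > 0"
      then obtain n where n: "(1/2)^n < e" using real_arch_pow_inv [of e "1/2"] by auto
      obtain y where "u (Suc n) \<subseteq> mball y ((1/2)^n)" using u(2) [of n] unfolding R_def by blast
      then have "C (Suc n) \<subseteq> mcball y e"
        using C_sub [of "Suc n"] mball_subset_mcball [of y "(1/2)^n"]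
          mcball_subset_concentric [of "(1/2)^n" e y] n by auto
      then show "\<exists>n a. C n \<subseteq> mcball a e" by blast
    qed
    then obtain y where y: "\<And>n. y \<in> C n" by blast
    then have yu: "y \<in> u n" for n using C_sub by blast
    have "(x, y) \<in> prod_topology X Y closure_of {(x, f x) | x. x \<in> topspace X}"
      unfolding in_closure_of
    proof (intro conjI allI impI)
      show "(x, y) \<in> topspace (prod_topology X Y)"
        using x yu [of 0] u(1) \<B>(2) openin_subset by fastforce
      fix T assume "(x, y) \<in> T \<and> openin (prod_topology X Y) T"
      then obtain P Q where PQ: "openin X P" "openin Y Q" "x \<in> P" "y \<in> Q" "P \<times> Q \<subseteq> T"
        by (metis openin_prod_topology_alt)
      obtain r where r: "r > 0" "mball y r \<subseteq> Q"
        using PQ unfolding Y_eq openin_mtopology by blast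
      obtain n where n: "(1/2)^n < r/2" using real_arch_pow_inv [of "r/2" "1/2"] r by auto
      obtain z where z: "u (Suc n) \<subseteq> mball z ((1/2)^n)" using u(2) [of n] unfolding R_def by blast
      have "u (Suc n) \<subseteq> mball y r"
      proof
        fix w assume "w \<in> u (Suc n)"
        then have "w \<in> mball z ((1/2)^n)" "y \<in> mball z ((1/2)^n)" using z yu [of "Suc n"] by auto
        then show "w \<in> mball y r" using n triangle [of y z w] commute [of y z] by auto
      qed
      moreover have "x \<in> X closure_of (A (u (Suc n)))" using V(3) u(1) by blast
      then obtain x' where x': "x' \<in> A (u (Suc n))" "x' \<in> P"
        using PQ unfolding in_closure_of by blast
      ultimately have "f x' \<in> Q" using r unfolding A_def by blast
      then have "(x', f x') \<in> T" using PQ x' by blast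
      moreover have "x' \<in> topspace X" using x' unfolding A_def by simp
      ultimately show "\<exists>p. p \<in> {(x, f x) |x. x \<in> topspace X} \<and> p \<in> T" by blast
    qed
    then have "y = f x" using closure_of_closedin [OF graph] by auto
    then show "x \<in> A U" using yu [of 0] u0 x unfolding A_def by simp
  qed
  have "continuous_map (subtopology X (topspace X - M)) Y f"
    unfolding continuous_map_def
  proof (intro conjI allI impI)
    show "f \<in> topspace (subtopology X (topspace X - M)) \<rightarrow> topspace Y" using f by auto
    fix Q assume Q: "openin Y Q"
    define N where "N = (\<Union>U\<in>{U \<in> \<B>. U \<subseteq> Q}. V U)"
    have "{x \<in> topspace (subtopology X (topspace X - M)). f x \<in> Q} = (topspace X - M) \<inter> N"
    proof (intro equalityI subsetI)
      fix x assume x: "x \<in> {x \<in> topspace (subtopology X (topspace X - M)). f x \<in> Q}"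
      then obtain U where U: "U \<in> \<B>" "f x \<in> U" "U \<subseteq> Q" using base [OF Q] by blast
      then have "x \<in> A U" using x unfolding A_def by simp
      then show "x \<in> (topspace X - M) \<inter> N" using A_V [OF _ _ U(1)] x U unfolding N_def by auto
    next
      fix x assume x: "x \<in> (topspace X - M) \<inter> N"
      then obtain U where U: "U \<in> \<B>" "x \<in> V U" "U \<subseteq> Q" unfolding N_def by blast
      then have "x \<in> A U" using A_V [OF _ _ U(1)] x by blast
      then show "x \<in> {x \<in> topspace (subtopology X (topspace X - M)). f x \<in> Q}"
        using x U unfolding A_def by auto
    qed
    moreover have "openin X N" unfolding N_def using V(1) by blast
    ultimately show "openin (subtopology X (topspace X - M))
        {x \<in> topspace (subtopology X (topspace X - M)). f x \<in> Q}"
      by (simp add: openin_subtopology_Int2)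
  qed
  ultimately show ?thesis using that by blast
qed

section \<open>Topological groups\<close>

lemma dense_subset_of_closed:
  assumes "dense_in_topology X D" "closedin X C" "D \<subseteq> C"
  shows "C = topspace X"
  using assms closure_of_minimal [of D C X] closedin_subset [of X C]
  unfolding dense_in_topology_def by blast

context topological_group
begin

lemma continuous_map_group_mult:
  assumes "continuous_map X T f" "continuous_map X T g"
  shows "continuous_map X T (\<lambda>x. f x \<otimes> g x)"
  using continuous_map_compose [OF continuous_map_pairedI [OF assms] continuous_mult]
  by (simp add: o_def)

lemma continuous_map_group_inv:
  assumes "continuous_map X T f"
  shows "continuous_map X T (\<lambda>x. inv (f x))"
  using continuous_map_compose [OF assms continuous_inv] by (simp add: o_def)

lemma continuous_map_group_const: "c \<in> carrier G \<Longrightarrow> continuous_map X T (\<lambda>x. c)"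
  by (simp add: topspace_eq)

lemmas continuous_group_intros =
  continuous_map_group_mult continuous_map_group_inv continuous_map_group_const continuous_map_id [unfolded id_def]

lemma homeomorphic_map_right_translation:
  assumes "c \<in> carrier G"
  shows "homeomorphic_map T T (\<lambda>x. x \<otimes> c)"
proof -
  have "homeomorphic_maps T T (\<lambda>x. x \<otimes> c) (\<lambda>x. x \<otimes> inv c)"
    unfolding homeomorphic_maps_def
    using assms by (auto intro!: continuous_group_intros simp: topspace_eq m_assoc)
  then show ?thesis using homeomorphic_map_maps by blast
qed

lemma subgroup_closure_of:
  assumes N: "subgroup N G"
  shows "subgroup (T closure_of N) G"
proof
  have sub: "N \<subseteq> T closure_of N"
    using closure_of_subset subgroup.subset [OF N] topspace_eq by metis
  show "T closure_of N \<subseteq> carrier G" using closure_of_subset_topspace topspace_eq by metis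
  show "\<one> \<in> T closure_of N" using sub subgroup.one_closed [OF N] by blast
  show "x \<otimes> y \<in> T closure_of N" if "x \<in> T closure_of N" "y \<in> T closure_of N" for x y
  proof -
    have "(\<lambda>(x, y). x \<otimes> y) ` (prod_topology T T closure_of (N \<times> N))
        \<subseteq> T closure_of ((\<lambda>(x, y). x \<otimes> y) ` (N \<times> N))"
      by (rule continuous_map_image_closure_subset [OF continuous_mult])
    also have "\<dots> \<subseteq> T closure_of N"
      by (rule closure_of_mono) (auto intro: subgroup.m_closed [OF N])
    finally show ?thesis using that by (auto simp: closure_of_Times)
  qed
  show "inv x \<in> T closure_of N" if "x \<in> T closure_of N" for x
  proof -
    have "(\<lambda>x. inv x) ` (T closure_of N) \<subseteq> T closure_of ((\<lambda>x. inv x) ` N)"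
      by (rule continuous_map_image_closure_subset [OF continuous_inv])
    also have "\<dots> \<subseteq> T closure_of N"
      by (rule closure_of_mono) (auto intro: subgroup.m_inv_closed [OF N])
    finally show ?thesis using that by blast
  qed
qed

text \<open>Conjugation by \<open>x\<close> is continuous, so elements of \<open>D\<close> also normalize the closure of \<open>N\<close>. For fixed
  \<open>k\<close> in this closure, the set of all \<open>x\<close> that conjugate \<open>k\<close> into it is closed and contains \<open>D\<close>.\<close>
lemma normal_closure_of_if_densely_normalized:
  assumes N: "subgroup N G" and D: "dense_in_topology T D"
    and conj: "\<And>d n. d \<in> D \<Longrightarrow> n \<in> N \<Longrightarrow> d \<otimes> n \<otimes> inv d \<in> N"
  shows "(T closure_of N) \<lhd> G"
proof (rule normal_invI)
  show "subgroup (T closure_of N) G" by (rule subgroup_closure_of [OF N])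
  fix x k assume x: "x \<in> carrier G" and k: "k \<in> T closure_of N"
  have D_sub: "D \<subseteq> carrier G" using D topspace_eq unfolding dense_in_topology_def by simp
  have k_G: "k \<in> carrier G" using k closure_of_subset_topspace topspace_eq by (metis subsetD)
  have "d \<otimes> k \<otimes> inv d \<in> T closure_of N" if d: "d \<in> D" for d
  proof -
    have "continuous_map T T (\<lambda>n. d \<otimes> n \<otimes> inv d)"
      using d D_sub by (intro continuous_group_intros) auto
    then have "(\<lambda>n. d \<otimes> n \<otimes> inv d) ` (T closure_of N) \<subseteq> T closure_of ((\<lambda>n. d \<otimes> n \<otimes> inv d) ` N)"
      by (rule continuous_map_image_closure_subset)
    also have "\<dots> \<subseteq> T closure_of N"
      by (rule closure_of_mono) (use conj d in auto)
    finally show ?thesis using k by blast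
  qed
  moreover have "continuous_map T T (\<lambda>x. x \<otimes> k \<otimes> inv x)"
    using k_G by (intro continuous_group_intros) auto
  then have "closedin T {x \<in> topspace T. x \<otimes> k \<otimes> inv x \<in> T closure_of N}"
    by (rule closedin_continuous_map_preimage) simp
  moreover have "x \<in> T closure_of D" using x D topspace_eq unfolding dense_in_topology_def by simp
  ultimately show "x \<otimes> k \<otimes> inv x \<in> T closure_of N"
    using forall_in_closure_of [of x T D "\<lambda>x. x \<otimes> k \<otimes> inv x \<in> T closure_of N"] by blast
qed

lemma central_if_commutes_with_dense:
  assumes "Hausdorff_space T" and D: "dense_in_topology T D" and n: "n \<in> carrier G"
    and comm: "\<And>d. d \<in> D \<Longrightarrow> n \<otimes> d = d \<otimes> n"
  shows "n \<in> group_center G"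
proof -
  have "n \<otimes> x = x \<otimes> n" if "x \<in> carrier G" for x
  proof (rule forall_in_closure_of_eq [of x T D T "\<lambda>x. n \<otimes> x" "\<lambda>x. x \<otimes> n"])
    show "x \<in> T closure_of D" using that D topspace_eq unfolding dense_in_topology_def by simp
  qed (use assms n in \<open>auto intro!: continuous_group_intros\<close>)
  then show ?thesis using n unfolding group_center_def by blast
qed

end

section \<open>A closed graph theorem for maps on Polish groups\<close>

lemma (in polish_group) second_countable: "second_countable T"
  by (intro separable_metrizable_imp_second_countable completely_metrizable_imp_metrizable_space
      separable completely_metrizable)

lemma (in polish_group) Hausdorff: "Hausdorff_space T"
  by (intro metrizable_imp_Hausdorff_space completely_metrizable_imp_metrizable_space
      completely_metrizable)

text \<open>The hypothesis \<open>transl\<close> says that \<open>f\<close> looks the same near \<open>x\<close> and near \<open>k \<otimes> x\<close>. It holds for a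
  homomorphism into a topological group, with \<open>\<alpha>\<close> a translation, and for the orbit map of an
  action by continuous maps, with \<open>\<alpha>\<close> the action of \<open>inv k\<close>; both cases are needed below.

  The map is continuous off a meager set \<open>M\<close>. Given a sequence \<open>\<sigma>\<close> converging to \<open>l\<close>, the elements
  \<open>k\<close> that move \<open>l\<close> or some \<open>\<sigma> n\<close> into \<open>M\<close> form a countable union of translates of \<open>M\<close>. So some
  \<open>k\<close> moves the whole sequence and its limit off \<open>M\<close>, where \<open>f\<close> is continuous, and \<open>\<alpha>\<close> moves the
  values back.\<close>
lemma (in polish_group) closed_graph_translation_continuous:
  assumes Y: "second_countable Y" "completely_metrizable_space Y"
    and f: "f \<in> carrier G \<rightarrow> topspace Y"
    and graph: "closedin (prod_topology T Y) {(x, f x) | x. x \<in> carrier G}"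
    and transl: "\<And>k. k \<in> carrier G \<Longrightarrow>
      \<exists>\<alpha>. continuous_map Y Y \<alpha> \<and> (\<forall>x\<in>carrier G. f x = \<alpha> (f (k \<otimes> x)))"
  shows "continuous_map T Y f"
proof -
  obtain M where M: "meager_in T M" "continuous_map (subtopology T (topspace T - M)) Y f"
    using closed_graph_continuous_off_meager [OF second_countable Y
        f [folded topspace_eq] graph [folded topspace_eq]] .
  obtain S d where "Metric_space S d" and T_eq: "T = Metric_space.mtopology S d"
    using completely_metrizable unfolding completely_metrizable_space_def by blast
  then interpret Metric_space S d by simp
  have seq: "f l \<in> C" if C: "closedin Y C" and \<sigma>: "range \<sigma> \<subseteq> {x \<in> topspace T. f x \<in> C}"
      and lim: "limitin T \<sigma> l sequentially" for C l and \<sigma> :: "nat \<Rightarrow> 'a"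
  proof -
    \<comment> \<open>One sequence that enumerates the limit together with all terms.\<close>
    define \<rho> where "\<rho> n = (case n of 0 \<Rightarrow> l | Suc m \<Rightarrow> \<sigma> m)" for n
    have l: "l \<in> carrier G" using limitin_topspace [OF lim] topspace_eq by simp
    have \<sigma>_G: "\<sigma> n \<in> carrier G" "f (\<sigma> n) \<in> C" for n using \<sigma> topspace_eq by auto
    have \<rho>_G: "\<rho> n \<in> carrier G" for n using l \<sigma>_G unfolding \<rho>_def by (simp split: nat.split)
    define B where "B = (\<Union>n. (\<lambda>x. x \<otimes> inv (\<rho> n)) ` M)"
    have "meager_in T B"
      unfolding B_def
    proof (rule meager_in_UN)
      show "meager_in T ((\<lambda>x. x \<otimes> inv (\<rho> n)) ` M)" for n
        using \<rho>_G by (intro meager_in_homeomorphic_image [OF _ M(1)] homeomorphic_map_right_translation) simp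
    qed simp
    then have "\<not> carrier G \<subseteq> B"
      using meager_in_topspace_iff_empty [OF completely_metrizable] meager_in_subset [of T B "carrier G"]
        one_closed topspace_eq by auto
    then obtain k where k: "k \<in> carrier G" "k \<notin> B" by blast
    have "k \<otimes> \<rho> n \<notin> M" for n
    proof
      assume "k \<otimes> \<rho> n \<in> M"
      moreover have "k = k \<otimes> \<rho> n \<otimes> inv (\<rho> n)" using k(1) \<rho>_G [of n] by (simp add: m_assoc)
      ultimately show False using k(2) unfolding B_def by blast
    qed
    from this [of 0] this [of "Suc _"] have off: "k \<otimes> l \<notin> M" "\<And>n. k \<otimes> \<sigma> n \<notin> M"
      unfolding \<rho>_def by simp_all
    have "continuous_map T T (\<lambda>x. k \<otimes> x)"
      using k by (intro continuous_group_intros) auto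
    from continuous_map_limit [OF this lim]
    have "limitin T (\<lambda>n. k \<otimes> \<sigma> n) (k \<otimes> l) sequentially" by (simp add: o_def)
    then have "limitin (subtopology T (topspace T - M)) (\<lambda>n. k \<otimes> \<sigma> n) (k \<otimes> l) sequentially"
      unfolding limitin_subtopology using off k(1) l \<sigma>_G topspace_eq by simp
    from continuous_map_limit [OF M(2) this]
    have lim_f: "limitin Y (\<lambda>n. f (k \<otimes> \<sigma> n)) (f (k \<otimes> l)) sequentially" by (simp add: o_def)
    obtain \<alpha> where \<alpha>: "continuous_map Y Y \<alpha>" "\<And>x. x \<in> carrier G \<Longrightarrow> f x = \<alpha> (f (k \<otimes> x))"
      using transl [OF k(1)] by blast
    from continuous_map_limit [OF \<alpha>(1) lim_f]
    have "limitin Y (\<lambda>n. f (\<sigma> n)) (f l) sequentially"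
      using \<alpha>(2) l \<sigma>_G(1) by (simp add: o_def)
    then show "f l \<in> C" using C \<sigma>_G(2) by (intro limitin_closedin [of Y _ "f l" sequentially C]) auto
  qed
  show ?thesis
    unfolding continuous_map_closedin
  proof (intro conjI ballI allI impI)
    show "f \<in> topspace T \<rightarrow> topspace Y" using f topspace_eq by simp
    fix C assume "closedin Y C"
    then have "l \<in> {x \<in> topspace T. f x \<in> C}"
      if "range \<sigma> \<subseteq> {x \<in> topspace T. f x \<in> C}" "limitin T \<sigma> l sequentially" for \<sigma> l
      using seq [OF _ that] limitin_topspace [OF that(2)] by simp
    moreover have "{x \<in> topspace T. f x \<in> C} \<subseteq> S" using T_eq by auto
    ultimately show "closedin T {x \<in> topspace T. f x \<in> C}"
      using metric_closedin_iff_sequentially_closed [folded T_eq] by (metis (no_types, lifting))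
  qed
qed

section \<open>Normal compressions\<close>

locale compression = G: topological_group G T + H: topological_group H S
  for G :: "('a, 'c) monoid_scheme" and T and H :: "('b, 'd) monoid_scheme" and S +
  fixes \<psi>
  assumes compression: "normal_compression G T H S \<psi>"
    and Hausdorff_codomain: "Hausdorff_space S"
begin

lemma hom: "\<psi> \<in> hom G H"
  and continuous: "continuous_map T S \<psi>"
  and inj: "inj_on \<psi> (carrier G)"
  and dense: "dense_in_topology S (\<psi> ` carrier G)"
  and normal_image: "\<psi> ` carrier G \<lhd> H"
  using compression unfolding normal_compression_def by auto

sublocale group_hom G H \<psi>
  using hom by unfold_locales

text \<open>A closed normal subgroup \<open>N\<close> of \<open>H\<close> pulls back to a closed normal subgroup of \<open>G\<close>. If the pullback
  is everything, then \<open>N\<close> contains the dense image of \<open>\<psi>\<close>. If it is trivial, then \<open>N\<close> and the image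
  are normal subgroups with trivial intersection; hence they commute, and \<open>N\<close> is central because
  the image is dense.\<close>
lemma topologically_simple_codomain:
  assumes G: "topologically_simple G T" and center: "centerless H"
  shows "topologically_simple H S"
  unfolding topologically_simple_def
proof (intro conjI allI impI)
  show "topological_group H S" by unfold_locales
  show "carrier H \<noteq> {\<one>\<^bsub>H\<^esub>}"
  proof
    assume "carrier H = {\<one>\<^bsub>H\<^esub>}"
    then have "x = \<one>\<^bsub>G\<^esub>" if "x \<in> carrier G" for x
      using inj_onD [OF inj, of x "\<one>\<^bsub>G\<^esub>"] that hom_closed by auto
    then show False using G unfolding topologically_simple_def by auto
  qed
  fix N assume N: "N \<lhd> H \<and> closedin S N"
  then have N_sub: "subgroup N H" using H.normal_inv_iff by blast
  define L where "L = {g \<in> carrier G. \<psi> g \<in> N}"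
  have "L \<lhd> G"
  proof (rule G.normal_invI)
    show "subgroup L G"
      unfolding L_def
      by (rule G.subgroupI)
        (use subgroup.one_closed [OF N_sub] subgroup.m_closed [OF N_sub] subgroup.m_inv_closed [OF N_sub]
         in \<open>auto intro: exI [of _ "\<one>\<^bsub>G\<^esub>"]\<close>)
    show "x \<otimes>\<^bsub>G\<^esub> h \<otimes>\<^bsub>G\<^esub> inv\<^bsub>G\<^esub> x \<in> L" if "x \<in> carrier G" "h \<in> L" for x h
      using that H.normal_invE(2) [of N] N unfolding L_def by auto
  qed
  moreover have "closedin T L"
    using closedin_continuous_map_preimage [OF continuous] N unfolding L_def G.topspace_eq [symmetric] by blast
  ultimately consider "L = {\<one>\<^bsub>G\<^esub>}" | "L = carrier G"
    using G unfolding topologically_simple_def by blast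
  then show "N = {\<one>\<^bsub>H\<^esub>} \<or> N = carrier H"
  proof cases
    case 1
    have "n \<in> group_center H" if n: "n \<in> N" for n
    proof (rule H.central_if_commutes_with_dense [OF Hausdorff_codomain dense])
      show n_H: "n \<in> carrier H" using n subgroup.subset [OF N_sub] by blast
      fix d assume "d \<in> \<psi> ` carrier G"
      then obtain g where g: "g \<in> carrier G" "d = \<psi> g" by blast
      have d_H: "d \<in> carrier H" using g by simp
      let ?c = "n \<otimes>\<^bsub>H\<^esub> d \<otimes>\<^bsub>H\<^esub> inv\<^bsub>H\<^esub> n \<otimes>\<^bsub>H\<^esub> inv\<^bsub>H\<^esub> d"
      have "n \<otimes>\<^bsub>H\<^esub> d \<otimes>\<^bsub>H\<^esub> inv\<^bsub>H\<^esub> n \<in> \<psi> ` carrier G"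
        using H.normal_invE(2) [OF normal_image n_H] g by blast
      moreover have "inv\<^bsub>H\<^esub> d \<in> \<psi> ` carrier G" using g by (metis G.inv_closed hom_inv imageI)
      ultimately have "?c \<in> \<psi> ` carrier G"
        using H.normal_invE(1) [OF normal_image] subgroup.m_closed by metis
      moreover have "?c = n \<otimes>\<^bsub>H\<^esub> (d \<otimes>\<^bsub>H\<^esub> inv\<^bsub>H\<^esub> n \<otimes>\<^bsub>H\<^esub> inv\<^bsub>H\<^esub> d)"
        using n_H d_H by (simp add: H.m_assoc)
      then have "?c \<in> N"
        using n H.normal_invE(2) [of N d "inv\<^bsub>H\<^esub> n"] N d_H
          subgroup.m_closed [OF N_sub] subgroup.m_inv_closed [OF N_sub] by auto
      ultimately obtain x where "x \<in> L" "?c = \<psi> x" unfolding L_def by auto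
      then have "?c = \<one>\<^bsub>H\<^esub>" using 1 by simp
      then show "n \<otimes>\<^bsub>H\<^esub> d = d \<otimes>\<^bsub>H\<^esub> n"
        using n_H d_H H.inv_solve_right' [of "\<one>\<^bsub>H\<^esub>" "n \<otimes>\<^bsub>H\<^esub> d" "d \<otimes>\<^bsub>H\<^esub> n"]
        by (simp add: H.inv_mult_group H.m_assoc)
    qed
    then have "N \<subseteq> {\<one>\<^bsub>H\<^esub>}" using center unfolding centerless_def by blast
    then show ?thesis using subgroup.one_closed [OF N_sub] by blast
  next
    case 2
    then have "\<psi> ` carrier G \<subseteq> N" unfolding L_def by blast
    then show ?thesis using dense_subset_of_closed [OF dense] N H.topspace_eq by simp
  qed
qed

text \<open>Since the image of \<open>\<psi>\<close> is normal and \<open>\<psi>\<close> is injective, conjugation in \<open>H\<close> induces an action of \<open>H\<close>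
  on \<open>G\<close> that extends the action of \<open>G\<close> on itself by inner automorphisms.\<close>
definition act :: "'b \<Rightarrow> 'a \<Rightarrow> 'a" where
  "act h g = inv_into (carrier G) \<psi> (h \<otimes>\<^bsub>H\<^esub> \<psi> g \<otimes>\<^bsub>H\<^esub> inv\<^bsub>H\<^esub> h)"

lemma
  assumes "h \<in> carrier H" "g \<in> carrier G"
  shows act_closed [simp]: "act h g \<in> carrier G"
    and image_act [simp]: "\<psi> (act h g) = h \<otimes>\<^bsub>H\<^esub> \<psi> g \<otimes>\<^bsub>H\<^esub> inv\<^bsub>H\<^esub> h"
proof -
  have "h \<otimes>\<^bsub>H\<^esub> \<psi> g \<otimes>\<^bsub>H\<^esub> inv\<^bsub>H\<^esub> h \<in> \<psi> ` carrier G"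
    using H.normal_invE(2) [OF normal_image] assms by blast
  then show "act h g \<in> carrier G" "\<psi> (act h g) = h \<otimes>\<^bsub>H\<^esub> \<psi> g \<otimes>\<^bsub>H\<^esub> inv\<^bsub>H\<^esub> h"
    unfolding act_def by (simp_all add: inv_into_into f_inv_into_f)
qed

lemma act_eqI:
  assumes "h \<in> carrier H" "g \<in> carrier G" "g' \<in> carrier G"
    and "\<psi> g' = h \<otimes>\<^bsub>H\<^esub> \<psi> g \<otimes>\<^bsub>H\<^esub> inv\<^bsub>H\<^esub> h"
  shows "act h g = g'"
  using inj_onD [OF inj, of "act h g" g'] assms by simp

lemma act_mult:
  assumes "h \<in> carrier H" "g \<in> carrier G" "g' \<in> carrier G"
  shows "act h (g \<otimes>\<^bsub>G\<^esub> g') = act h g \<otimes>\<^bsub>G\<^esub> act h g'"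
  using assms by (intro act_eqI) (auto simp: H.m_assoc H.inv_solve_left')

lemma act_act:
  assumes "h \<in> carrier H" "k \<in> carrier H" "g \<in> carrier G"
  shows "act h (act k g) = act (h \<otimes>\<^bsub>H\<^esub> k) g"
  using assms by (intro act_eqI) (auto simp: H.m_assoc H.inv_mult_group)

lemma act_image:
  assumes "a \<in> carrier G" "g \<in> carrier G"
  shows "act (\<psi> a) g = a \<otimes>\<^bsub>G\<^esub> g \<otimes>\<^bsub>G\<^esub> inv\<^bsub>G\<^esub> a"
  using assms by (intro act_eqI) auto

text \<open>The topology of \<open>G\<close> may be strictly finer than the one induced from \<open>H\<close>, so continuity of \<open>\<psi>\<close>
  only yields a closed graph: it is the set where two continuous maps into \<open>H\<close> agree.\<close>
lemma continuous_act:
  assumes "polish_group G T" and h: "h \<in> carrier H"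
  shows "continuous_map T T (act h)"
proof (rule polish_group.closed_graph_translation_continuous [OF assms(1)])
  interpret polish_group G T by fact
  show "second_countable T" "completely_metrizable_space T"
    by (rule second_countable, rule completely_metrizable)
  show "act h \<in> carrier G \<rightarrow> topspace T" using h G.topspace_eq by simp
  have "{(x, act h x) |x. x \<in> carrier G} =
      {p \<in> topspace (prod_topology T T). \<psi> (snd p) = h \<otimes>\<^bsub>H\<^esub> \<psi> (fst p) \<otimes>\<^bsub>H\<^esub> inv\<^bsub>H\<^esub> h}"
    using h by (auto simp: G.topspace_eq act_eqI)
  moreover have "continuous_map (prod_topology T T) S (\<lambda>p. \<psi> (fst p))"
    "continuous_map (prod_topology T T) S (\<lambda>p. \<psi> (snd p))"
    using continuous_map_compose [OF continuous_map_fst continuous]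
      continuous_map_compose [OF continuous_map_snd continuous] by (simp_all add: o_def)
  ultimately show "closedin (prod_topology T T) {(x, act h x) |x. x \<in> carrier G}"
    using closedin_continuous_maps_eq [OF Hausdorff_codomain, of _ "\<lambda>p. \<psi> (snd p)"
        "\<lambda>p. h \<otimes>\<^bsub>H\<^esub> \<psi> (fst p) \<otimes>\<^bsub>H\<^esub> inv\<^bsub>H\<^esub> h"] h
    by (simp add: H.continuous_map_group_mult H.topspace_eq del: topspace_prod_topology)
  fix k assume k: "k \<in> carrier G"
  have "act h x = inv\<^bsub>G\<^esub> (act h k) \<otimes>\<^bsub>G\<^esub> act h (k \<otimes>\<^bsub>G\<^esub> x)" if "x \<in> carrier G" for x
    using that h k by (simp add: act_mult G.m_assoc [symmetric])
  moreover have "continuous_map T T (\<lambda>y. inv\<^bsub>G\<^esub> (act h k) \<otimes>\<^bsub>G\<^esub> y)"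
    using h k by (intro G.continuous_group_intros) auto
  ultimately show "\<exists>\<alpha>. continuous_map T T \<alpha> \<and> (\<forall>x\<in>carrier G. act h x = \<alpha> (act h (k \<otimes>\<^bsub>G\<^esub> x)))"
    by blast
qed

text \<open>The same argument with \<open>H\<close> as the domain. The orbit map is not a homomorphism, but it satisfies
  \<open>act h g = act (inv k) (act (k \<otimes> h) g)\<close>, and \<open>act (inv k)\<close> is already known to be continuous.\<close>
lemma continuous_orbit_map:
  assumes "polish_group G T" "polish_group H S" and g: "g \<in> carrier G"
  shows "continuous_map S T (\<lambda>h. act h g)"
proof (rule polish_group.closed_graph_translation_continuous [OF assms(2)])
  interpret polish_group G T by fact
  show "second_countable T" "completely_metrizable_space T"
    by (rule second_countable, rule completely_metrizable)
  show "(\<lambda>h. act h g) \<in> carrier H \<rightarrow> topspace T" using g G.topspace_eq by simp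
  have "{(h, act h g) |h. h \<in> carrier H} =
      {p \<in> topspace (prod_topology S T). \<psi> (snd p) = fst p \<otimes>\<^bsub>H\<^esub> \<psi> g \<otimes>\<^bsub>H\<^esub> inv\<^bsub>H\<^esub> (fst p)}"
    using g by (auto simp: G.topspace_eq H.topspace_eq act_eqI)
  moreover have "continuous_map (prod_topology S T) S (\<lambda>p. \<psi> (snd p))"
    using continuous_map_compose [OF continuous_map_snd continuous] by (simp add: o_def)
  ultimately show "closedin (prod_topology S T) {(h, act h g) |h. h \<in> carrier H}"
    using closedin_continuous_maps_eq [OF Hausdorff_codomain, of _ "\<lambda>p. \<psi> (snd p)"
        "\<lambda>p. fst p \<otimes>\<^bsub>H\<^esub> \<psi> g \<otimes>\<^bsub>H\<^esub> inv\<^bsub>H\<^esub> (fst p)"] g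
    by (simp add: H.continuous_map_group_mult H.continuous_map_group_inv H.topspace_eq
        continuous_map_fst del: topspace_prod_topology)
  fix k assume k: "k \<in> carrier H"
  have "act h g = act (inv\<^bsub>H\<^esub> k) (act (k \<otimes>\<^bsub>H\<^esub> h) g)" if "h \<in> carrier H" for h
    using that g k by (simp add: act_act H.m_assoc [symmetric])
  moreover have "continuous_map T T (act (inv\<^bsub>H\<^esub> k))"
    using continuous_act assms(1) k by simp
  ultimately show "\<exists>\<alpha>. continuous_map T T \<alpha> \<and> (\<forall>h\<in>carrier H. act h g = \<alpha> (act (k \<otimes>\<^bsub>H\<^esub> h) g))"
    by blast
qed

text \<open>Modulo \<open>N\<close>, the elements of \<open>\<psi> ` N\<close> act trivially, since \<open>n \<otimes> g \<otimes> inv n \<otimes> inv g \<in> N\<close>. The orbit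
  map at \<open>g\<close> is continuous and \<open>N\<close> is closed, so by density all of \<open>H\<close> acts trivially modulo \<open>N\<close>. For
  elements of \<open>\<psi> ` carrier G\<close> this says that \<open>G\<close> is commutative modulo \<open>N\<close>.\<close>
lemma derived_subset_if_dense_image:
  assumes "polish_group G T" "polish_group H S"
    and N: "N \<lhd> G" "closedin T N" and dense_N: "dense_in_topology S (\<psi> ` N)"
  shows "derived G (carrier G) \<subseteq> N"
proof -
  note N_sub = G.normal_invE(1) [OF N(1)] and N_conj = G.normal_invE(2) [OF N(1)]
  have key: "act h g \<otimes>\<^bsub>G\<^esub> inv\<^bsub>G\<^esub> g \<in> N" if h: "h \<in> carrier H" and g: "g \<in> carrier G" for h g
  proof (rule forall_in_closure_of [of h S "\<psi> ` N"])
    show "h \<in> S closure_of \<psi> ` N"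
      using dense_N h H.topspace_eq unfolding dense_in_topology_def by simp
    show "closedin S {h \<in> topspace S. act h g \<otimes>\<^bsub>G\<^esub> inv\<^bsub>G\<^esub> g \<in> N}"
    proof (rule closedin_continuous_map_preimage [OF _ N(2)])
      show "continuous_map S T (\<lambda>h. act h g \<otimes>\<^bsub>G\<^esub> inv\<^bsub>G\<^esub> g)"
        using g by (intro G.continuous_map_group_mult continuous_orbit_map [OF assms(1,2)]
            G.continuous_map_group_const) simp_all
    qed
    fix h assume "h \<in> \<psi> ` N"
    then obtain n where n: "n \<in> N" "h = \<psi> n" by blast
    then have n_G: "n \<in> carrier G" using subgroup.subset [OF N_sub] by blast
    have "act h g \<otimes>\<^bsub>G\<^esub> inv\<^bsub>G\<^esub> g = n \<otimes>\<^bsub>G\<^esub> (g \<otimes>\<^bsub>G\<^esub> inv\<^bsub>G\<^esub> n \<otimes>\<^bsub>G\<^esub> inv\<^bsub>G\<^esub> g)"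
      using n n_G g by (simp add: act_image G.m_assoc)
    then show "act h g \<otimes>\<^bsub>G\<^esub> inv\<^bsub>G\<^esub> g \<in> N"
      using n g N_conj subgroup.m_closed [OF N_sub] subgroup.m_inv_closed [OF N_sub] by simp
  qed
  have "derived_set G (carrier G) \<subseteq> N"
    using key [OF hom_closed] by (auto simp: act_image)
  then show ?thesis
    unfolding derived_def by (rule G.generate_subgroup_incl [OF _ N_sub])
qed

text \<open>For a closed normal subgroup \<open>N\<close> of \<open>G\<close>, the closure of \<open>\<psi> ` N\<close> is normalized by the dense image of \<open>\<psi>\<close>
  and hence normal in \<open>H\<close>. If it is trivial, so is \<open>N\<close>; otherwise \<open>\<psi> ` N\<close> is dense in \<open>H\<close>, and \<open>N\<close>
  contains the dense commutator subgroup of \<open>G\<close>.\<close>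
lemma topologically_simple_domain:
  assumes "polish_group G T" "polish_group H S"
    and H: "topologically_simple H S" and derived: "dense_in_topology T (derived G (carrier G))"
  shows "topologically_simple G T"
  unfolding topologically_simple_def
proof (intro conjI allI impI)
  show "topological_group G T" by unfold_locales
  have closed_one: "closedin S {\<one>\<^bsub>H\<^esub>}"
    using Hausdorff_codomain H.topspace_eq by (simp add: closedin_Hausdorff_singleton)
  show "carrier G \<noteq> {\<one>\<^bsub>G\<^esub>}"
  proof
    assume "carrier G = {\<one>\<^bsub>G\<^esub>}"
    then have "{\<one>\<^bsub>H\<^esub>} = carrier H"
      using dense_subset_of_closed [OF dense closed_one] H.topspace_eq by simp
    then show False using H unfolding topologically_simple_def by simp
  qed
  fix N assume N: "N \<lhd> G \<and> closedin T N"
  then have N_sub: "subgroup N G" using G.normal_inv_iff by blast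
  then have N_G: "N \<subseteq> carrier G" by (rule subgroup.subset)
  let ?K = "S closure_of (\<psi> ` N)"
  have sub: "\<psi> ` N \<subseteq> ?K"
    by (rule closure_of_subset) (use N_G H.topspace_eq in auto)
  have "?K \<lhd> H"
  proof (rule H.normal_closure_of_if_densely_normalized [OF _ dense])
    show "subgroup (\<psi> ` N) H" by (rule subgroup_img_is_subgroup [OF N_sub])
    fix d n assume "d \<in> \<psi> ` carrier G" "n \<in> \<psi> ` N"
    then obtain g m where gm: "g \<in> carrier G" "d = \<psi> g" "m \<in> N" "n = \<psi> m" by blast
    then have "d \<otimes>\<^bsub>H\<^esub> n \<otimes>\<^bsub>H\<^esub> inv\<^bsub>H\<^esub> d = \<psi> (g \<otimes>\<^bsub>G\<^esub> m \<otimes>\<^bsub>G\<^esub> inv\<^bsub>G\<^esub> g)"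
      using N_G by (auto dest!: subsetD)
    then show "d \<otimes>\<^bsub>H\<^esub> n \<otimes>\<^bsub>H\<^esub> inv\<^bsub>H\<^esub> d \<in> \<psi> ` N"
      using G.normal_invE(2) [of N g m] N gm by simp
  qed
  then consider "?K = {\<one>\<^bsub>H\<^esub>}" | "?K = carrier H"
    using H closedin_closure_of unfolding topologically_simple_def by metis
  then show "N = {\<one>\<^bsub>G\<^esub>} \<or> N = carrier G"
  proof cases
    case 1
    have "n = \<one>\<^bsub>G\<^esub>" if "n \<in> N" for n
      using inj_onD [OF inj, of n "\<one>\<^bsub>G\<^esub>"] that N_G sub 1 by auto
    then show ?thesis using subgroup.one_closed [OF N_sub] by blast
  next
    case 2
    then have "dense_in_topology S (\<psi> ` N)"
      using N_G H.topspace_eq unfolding dense_in_topology_def by auto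
    then have "derived G (carrier G) \<subseteq> N" using derived_subset_if_dense_image assms(1,2) N by blast
    then show ?thesis using dense_subset_of_closed [OF derived] N G.topspace_eq by simp
  qed
qed

end

section \<open>Equivalence of topological simplicity\<close>

theorem theorem1p4:
  fixes G :: "('a, 'c) monoid_scheme" and T :: "'a topology"
    and H :: "('b, 'd) monoid_scheme" and S :: "'b topology"
  assumes "polish_group G T" and "polish_group H S"
    and "centerless G" and "centerless H"
    and "dense_in_topology T (derived G (carrier G))"
    and "dense_in_topology S (derived H (carrier H))"
    and "\<exists>\<psi>. normal_compression G T H S \<psi>"
  shows "topologically_simple G T \<longleftrightarrow> topologically_simple H S"
proof -
  interpret G: polish_group G T by fact
  interpret H: polish_group H S by fact
  obtain \<psi> where \<psi>: "normal_compression G T H S \<psi>" using assms(7) by blast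
  interpret compression G T H S \<psi>
    by unfold_locales (fact \<psi>, fact H.Hausdorff)
  show ?thesis
    using topologically_simple_codomain [OF _ assms(4)]
      topologically_simple_domain [OF assms(1,2) _ assms(5)] by iprover
qed

end
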